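(* Let $m,n\ge 3$ be integers and $G=K_m\Box K_n$. Then $cs(G)=\alpha(m,n)$, where \[ \alpha(m,n) = \min\left\{mn-\sum_{i=1}^2m_in_i +\max\left\{\left\lceil\frac{\max\{m_1n_1,m_2n_2\} - mn+\sum_{i=1}^2m_in_i}{2}\right\rceil ,1 \right\} \right\}, \] the minimum being taken over all $((m_1,m_2),(n_1,n_2))$ with $m_1,m_2,n_1,n_2$ positive integers, $m_1+m_2=m$ and $n_1+n_2=n$.
   Context: For a connected graph $G$ and $X\subseteq V(G)$, $G[X]$ denotes the subgraph induced by $X$. A set $S\subseteq V(G)$ is a safe set if for every component $C$ of $G[S]$ and every component $D$ of $G-S$ such that some edge joins $C$ and $D$, we have $|C|\ge |D|$. If moreover $G[S]$ is connected, $S$ is a connected safe set. The connected safe number $cs(G)$ is the minimum size of a connected safe set of $G$. $K_m \Box K_n$ has vertex set $[m]\times[n]$, with $(i,j)$ and $(i',j')$ adjacent iff either $i=i'$ and $j\neq j'$, or $j=j'$ and $i\ne i'$. *)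

theory Defs
  imports Complex_Main "Graph_Theory.Graph_Theory"
begin

text \<open>
  Undirected graphs are modelled as symmetric digraphs (locale \<^locale>\<open>graph\<close>).
\<close>

definition components :: "('a, 'b) pre_digraph \<Rightarrow> ('a, 'b) pre_digraph set" where
  "components G = {C. pre_digraph.max_subgraph G connected C}"

text \<open>
  In the next definition \<open>G\<close> is meant to be symmetric, so that the direction of the arc from
  \<open>C\<close> to \<open>D\<close> is irrelevant.
\<close>

definition safe_set :: "('a, 'b) pre_digraph \<Rightarrow> 'a set \<Rightarrow> bool" where
  "safe_set G S \<longleftrightarrow> S \<subseteq> verts G \<and>
     (\<forall>C \<in> components (G \<restriction> S). \<forall>D \<in> components (G \<restriction> (verts G - S)).
        (\<exists>u \<in> verts C. \<exists>v \<in> verts D. u \<rightarrow>\<^bsub>G\<^esub> v) \<longrightarrow> card (verts C) \<ge> card (verts D))"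

text \<open>
  The library's \<^const>\<open>connected\<close> is false for the graph without vertices, so a connected safe
  set is nonempty.
\<close>

definition connected_safe_set :: "('a, 'b) pre_digraph \<Rightarrow> 'a set \<Rightarrow> bool" where
  "connected_safe_set G S \<longleftrightarrow> safe_set G S \<and> connected (G \<restriction> S)"

definition cs :: "('a, 'b) pre_digraph \<Rightarrow> nat" where
  "cs G = (LEAST k. \<exists>S. connected_safe_set G S \<and> card S = k)"

definition K_box_K :: "nat \<Rightarrow> nat \<Rightarrow> (nat \<times> nat, (nat \<times> nat) \<times> (nat \<times> nat)) pre_digraph" where
  "K_box_K m n = with_proj
     \<lparr> pverts = {1..m} \<times> {1..n},
       parcs = {((i, j), (i', j')). (i, j) \<in> {1..m} \<times> {1..n} \<and> (i', j') \<in> {1..m} \<times> {1..n} \<and>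
                  (i = i' \<and> j \<noteq> j' \<or> j = j' \<and> i \<noteq> i')} \<rparr>"

text \<open>Integer-valued, because the numerator under the ceiling may be negative.\<close>

definition alpha :: "nat \<Rightarrow> nat \<Rightarrow> int" where
  "alpha m n = Min
     {int (m * n) - int (m1 * n1 + m2 * n2) +
        max \<lceil>(real (max (m1 * n1) (m2 * n2)) - real (m * n) + real (m1 * n1 + m2 * n2)) / 2\<rceil> 1
      | m1 m2 n1 n2 :: nat.
        m1 > 0 \<and> m2 > 0 \<and> n1 > 0 \<and> n2 > 0 \<and> m1 + m2 = m \<and> n1 + n2 = n}"


lemma graph_K_box_K: "graph (K_box_K m n)"
proof -
  let ?R = "{((i, j), (i', j')). (i, j) \<in> {1..m} \<times> {1..n} \<and> (i', j') \<in> {1..m} \<times> {1..n} \<and>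
                  (i = i' \<and> j \<noteq> j' \<or> j = j' \<and> i \<noteq> i')}"
  have "?R \<subseteq> ({1..m} \<times> {1..n}) \<times> ({1..m} \<times> {1..n})" by auto
  then have "finite ?R" by (rule finite_subset) auto
  moreover have "sym ?R" by (auto simp: sym_def)
  ultimately show ?thesis
    unfolding K_box_K_def
    by unfold_locales (auto simp: arc_to_ends_def symmetric_def)
qed

lemma arc_mono_connected: "arc_mono connected"
  unfolding arc_mono_def spanning_def[symmetric]
  by (metis spanning_def subgraphE wf_digraph.connected_spanning_imp_connected)

lemma strongly_connected_imp_connected:
  assumes "wf_digraph G" "strongly_connected G"
  shows "connected G"
proof -
  interpret wf_digraph G by fact
  show ?thesis
    using assms(2) reachable_mk_symmetricI
    unfolding connected_def strongly_connected_def by (auto simp: mk_symmetric_def)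
qed

lemma components_eq_sccs:
  fixes G :: "('a, 'b) pre_digraph"
  assumes "graph G"
  shows "components G = pre_digraph.sccs G"
proof -
  interpret graph G by fact
  note mono = arc_mono_connected
  have "max_subgraph connected C \<longleftrightarrow> max_subgraph strongly_connected C" for C :: "('a, 'b) pre_digraph"
  proof
    assume C: "max_subgraph connected C"
    then have i: "induced_subgraph C G" using mono by (rule induced_subgraphI_arc_mono)
    then have w: "wf_digraph C" by (simp add: induced_subgraph_def subgraph_def)
    from i have "symmetric C" using sym_arcs induced_graph_imp_symmetric by blast
    with C w have "strongly_connected C"
      by (meson max_subgraph_prop wf_digraph.symmetric_connected_imp_strongly_connected)
    with C show "max_subgraph strongly_connected C"
      unfolding max_subgraph_def subgraph_def
      using strongly_connected_imp_connected by blast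
  next
    assume C: "max_subgraph strongly_connected C"
    then have sc: "C \<in> sccs" by (simp add: sccs_altdef2)
    show "max_subgraph connected C"
    proof (rule max_subgraphI)
      show "subgraph C G" using C by (rule subgraphI_max_subgraph)
      then have "wf_digraph C" by (simp add: subgraph_def)
      then show "connected C"
        using C by (meson max_subgraph_prop strongly_connected_imp_connected)
      fix y assume y: "C \<noteq> y" "subgraph C y" "subgraph y G"
      show "\<not> connected y"
      proof
        assume "connected y"
        have wy: "wf_digraph y" using y(3) by (simp add: subgraph_def)
        let ?Y = "G \<restriction> verts y"
        have vy: "verts y \<subseteq> verts G" using y(3) by (simp add: subgraph_def)
        have sY: "subgraph y ?Y" using y(3) by (rule subgraph_induce_subgraphI2)
        then have "connected ?Y" using mono \<open>connected y\<close>
          unfolding arc_mono_def by (metis induce_subgraph_verts)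
        moreover have iY: "induced_subgraph ?Y G" using vy by (rule induced_induce)
        moreover have "symmetric ?Y" using sym_arcs iY induced_graph_imp_symmetric by blast
        moreover have "wf_digraph ?Y" using iY by (simp add: induced_subgraph_def subgraph_def)
        ultimately have "strongly_connected ?Y"
          by (metis wf_digraph.symmetric_connected_imp_strongly_connected)
        moreover have "subgraph C ?Y" using y(2) sY by (rule subgraph_trans)
        moreover have "subgraph ?Y G" using iY by (simp add: induced_subgraph_def)
        ultimately have "C = ?Y" using C unfolding max_subgraph_def by metis
        with y(2) sY have "C = y"
          by (auto simp: subgraph_def compatible_def intro!: pre_digraph.equality)
        with y(1) show False by simp
      qed
    qed
  qed
  then show ?thesis unfolding components_def sccs_altdef2 by blast
qed

end

theory Submission
  imports Defs
begin

text \<open>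
  A partition of the rows and of the columns into two parts each cuts the grid into two diagonal
  and two off-diagonal blocks. The off-diagonal blocks, together with at least one vertex of a
  larger diagonal block, induce a connected subgraph, and adding vertices of that block until they
  are at least as many as those of it left over gives a safe set; the other diagonal block is never
  too large, as it is no larger than the off-diagonal part.

  Conversely, let \<open>S\<close> be a connected safe set. Distinct components of the complement share no row
  and no column. If the complement has at most as many vertices as \<open>S\<close>, splitting off a single row
  and a single column gives a partition whose value is at most \<open>card S\<close>. Otherwise, let \<open>D\<close> be its largest component and
  cut the grid so that \<open>D\<close> lies in one diagonal block and all other components in the other. The
  off-diagonal blocks lie in \<open>S\<close>, properly since alone they are disconnected. Both \<open>D\<close> and the union
  of the other components have at most \<open>card S\<close> vertices, and this is what the ceiling in the
  formula requires.
\<close>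

section \<open>Adjacency in the grid and strong components of induced subgraphs\<close>

lemma verts_K_box_K [simp]: "verts (K_box_K m n) = {1..m} \<times> {1..n}"
  by (simp add: K_box_K_def)

lemma dominates_K_box_K:
  "p \<rightarrow>\<^bsub>K_box_K m n\<^esub> q \<longleftrightarrow> p \<in> {1..m} \<times> {1..n} \<and> q \<in> {1..m} \<times> {1..n} \<and> p \<noteq> q \<and>
     (fst p = fst q \<or> snd p = snd q)"
  by (cases p; cases q) (auto simp: K_box_K_def arcs_ends_def arc_to_ends_def)

lemma dominates_induce_subgraph:
  "u \<rightarrow>\<^bsub>G \<restriction> X\<^esub> v \<longleftrightarrow> u \<rightarrow>\<^bsub>G\<^esub> v \<and> u \<in> X \<and> v \<in> X"
  by (auto simp: arcs_ends_def arc_to_ends_def)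

lemma graph_induce_subgraph:
  assumes "graph G" "X \<subseteq> verts G"
  shows "graph (G \<restriction> X)"
proof -
  interpret graph G by fact
  interpret H: sym_digraph "G \<restriction> X"
    using induced_induce[OF assms(2)] by (rule induced_graph_imp_graph)
  show ?thesis
    using finite_subset[OF assms(2)] no_loops no_multi_arcs
    by unfold_locales auto
qed

lemma connected_iff_strongly_connected:
  assumes "graph G"
  shows "connected G \<longleftrightarrow> strongly_connected G"
proof -
  interpret graph G by fact
  show ?thesis
    by (rule iffI[OF symmetric_connected_imp_strongly_connected[OF sym_arcs]
          strongly_connected_imp_connected[OF wf_digraph_axioms]])
qed

text \<open>\<open>safe_set\<close> looks at components only through their vertices, so vertex sets
  can replace the component subgraphs.\<close>

lemma verts_components:
  assumes "graph G"
  shows "verts ` components G = pre_digraph.sccs_verts G"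
proof -
  interpret graph G by fact
  show ?thesis
    by (simp add: components_eq_sccs[OF assms] sccs_verts_conv)
qed

lemma sccs_verts_strongly_connected:
  assumes "graph G" "strongly_connected G"
  shows "pre_digraph.sccs_verts G = {verts G}"
proof -
  interpret graph G by fact
  show ?thesis
  proof (intro equalityI subsetI)
    fix X assume X: "X \<in> sccs_verts"
    then have sub: "X \<subseteq> verts G" by (rule sccs_verts_subsets)
    from X obtain u where u: "u \<in> X" unfolding sccs_verts_def by blast
    have "v \<in> X" if "v \<in> verts G" for v
    proof -
      have "u \<rightarrow>\<^sup>*\<^bsub>G\<^esub> v" "v \<rightarrow>\<^sup>*\<^bsub>G\<^esub> u"
        using assms(2) that u sub unfolding strongly_connected_def by auto
      then show ?thesis using X u unfolding sccs_verts_def by blast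
    qed
    with sub show "X \<in> {verts G}" by blast
  next
    fix X assume "X \<in> {verts G}"
    then show "X \<in> sccs_verts"
      using assms(2) unfolding sccs_verts_def strongly_connected_def
      by (auto dest: reachable_in_verts)
  qed
qed

lemma sccs_verts_closed:
  assumes "graph G" "X \<in> pre_digraph.sccs_verts G" "u \<in> X" "u \<rightarrow>\<^bsub>G\<^esub> v"
  shows "v \<in> X"
proof -
  interpret graph G by fact
  have "u \<rightarrow>\<^sup>*\<^bsub>G\<^esub> v" using assms(4) by blast
  moreover from this have "v \<rightarrow>\<^sup>*\<^bsub>G\<^esub> u" using symmetric_reachable' by blast
  ultimately show ?thesis using assms(2,3) unfolding sccs_verts_def by blast
qed

lemma Union_sccs_verts:
  assumes "graph G"
  shows "\<Union> (pre_digraph.sccs_verts G) = verts G"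
proof -
  interpret graph G by fact
  show ?thesis
    using sccs_verts_subsets scc_of_in_sccs_verts in_scc_of_self by blast
qed

text \<open>Used to show that the two off-diagonal blocks alone are not connected: one of them is a
  closed set \<open>P\<close>.\<close>

lemma strongly_connected_closed:
  assumes "graph G" "strongly_connected G" "u \<in> verts G" "u \<in> P"
    and closed: "\<And>x y. x \<in> P \<Longrightarrow> x \<rightarrow>\<^bsub>G\<^esub> y \<Longrightarrow> y \<in> P"
  shows "verts G \<subseteq> P"
proof
  interpret graph G by fact
  fix v assume "v \<in> verts G"
  with assms have "u \<rightarrow>\<^sup>*\<^bsub>G\<^esub> v" unfolding strongly_connected_def by blast
  then show "v \<in> P"
    by (induction rule: reachable_induct) (use assms in auto)
qed

text \<open>Confines a component of the complement to a single diagonal block.\<close>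

lemma sccs_verts_subset_closed:
  assumes "graph G" "X \<in> pre_digraph.sccs_verts G" "u \<in> X" "u \<in> P"
    and closed: "\<And>x y. x \<in> P \<Longrightarrow> x \<rightarrow>\<^bsub>G\<^esub> y \<Longrightarrow> y \<in> P"
  shows "X \<subseteq> P"
proof
  interpret graph G by fact
  fix v assume "v \<in> X"
  with assms have "u \<rightarrow>\<^sup>*\<^bsub>G\<^esub> v" unfolding sccs_verts_def by blast
  then show "v \<in> P"
    by (induction rule: reachable_induct) (use assms in auto)
qed

text \<open>A connected \<open>S\<close> is its own only component, and every component of the
  complement is joined to it by an edge. The adjacency premise of \<open>safe_set\<close> therefore
  always holds, and only the sizes remain to be compared.\<close>

lemma connected_safe_set_K_box_K_iff:
  fixes m n :: nat and S
  defines "V \<equiv> {1..m} \<times> {1..n}" and "G \<equiv> K_box_K m n"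
  shows "connected_safe_set G S \<longleftrightarrow> S \<subseteq> V \<and> strongly_connected (G \<restriction> S) \<and>
     (\<forall>D \<in> pre_digraph.sccs_verts (G \<restriction> (V - S)). card D \<le> card S)"
proof (cases "S \<subseteq> V \<and> strongly_connected (G \<restriction> S)")
  case False
  have "graph (G \<restriction> S)" if "S \<subseteq> V"
    unfolding G_def using that by (intro graph_induce_subgraph[OF graph_K_box_K]) (simp add: V_def)
  with False show ?thesis
    unfolding connected_safe_set_def safe_set_def
    by (auto simp: connected_iff_strongly_connected V_def G_def)
next
  case True
  have gS: "graph (G \<restriction> S)" and gT: "graph (G \<restriction> (V - S))"
    unfolding G_def using True
    by (intro graph_induce_subgraph[OF graph_K_box_K]; auto simp: V_def)+
  have cS: "verts ` components (G \<restriction> S) = {S}"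
    using sccs_verts_strongly_connected[OF gS] True by (simp add: verts_components[OF gS])
  have adj: "\<exists>u\<in>S. \<exists>v\<in>D. u \<rightarrow>\<^bsub>G\<^esub> v" if D: "D \<in> pre_digraph.sccs_verts (G \<restriction> (V - S))" for D
  proof -
    have "D \<noteq> {}" using D unfolding pre_digraph.sccs_verts_def by blast
    then obtain c d where v: "(c, d) \<in> D" by auto
    have DT: "D \<subseteq> V - S" using Union_sccs_verts[OF gT] D by auto
    have "S \<noteq> {}" using True unfolding strongly_connected_def by auto
    then obtain a b where u: "(a, b) \<in> S" by auto
    have V: "(a, b) \<in> V" "(c, d) \<in> V" "(a, d) \<in> V" using u v DT True by (auto simp: V_def)
    show ?thesis
    \<comment> \<open>The corner \<open>(a, d)\<close> shares a line with both given cells. In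
      \<open>S\<close> it is a neighbour of \<open>(c, d)\<close>; outside \<open>S\<close> it
      belongs to \<open>D\<close> and is a neighbour of \<open>(a, b)\<close>.\<close>
    proof (cases "(a, d) \<in> S")
      case True
      then have "(a, d) \<rightarrow>\<^bsub>G\<^esub> (c, d)"
        using V v DT unfolding G_def V_def dominates_K_box_K by auto
      with True v show ?thesis by blast
    next
      case False
      have "(a, d) \<in> D"
      proof (cases "a = c")
        case False
        then have "(c, d) \<rightarrow>\<^bsub>G \<restriction> (V - S)\<^esub> (a, d)"
          using V v DT \<open>(a, d) \<notin> S\<close>
          unfolding dominates_induce_subgraph G_def V_def dominates_K_box_K by auto
        then show ?thesis using sccs_verts_closed[OF gT D v] by blast
      qed (use v in simp)
      moreover have "(a, b) \<rightarrow>\<^bsub>G\<^esub> (a, d)"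
        using V u False unfolding G_def V_def dominates_K_box_K by auto
      ultimately show ?thesis using u by blast
    qed
  qed
  have "safe_set G S \<longleftrightarrow> (\<forall>C \<in> verts ` components (G \<restriction> S).
      \<forall>D \<in> verts ` components (G \<restriction> (V - S)).
        (\<exists>u \<in> C. \<exists>v \<in> D. u \<rightarrow>\<^bsub>G\<^esub> v) \<longrightarrow> card C \<ge> card D)"
    using True unfolding safe_set_def by (simp add: V_def G_def)
  also have "\<dots> \<longleftrightarrow> (\<forall>D \<in> pre_digraph.sccs_verts (G \<restriction> (V - S)). card D \<le> card S)"
    unfolding cS verts_components[OF gT] using adj by auto
  finally show ?thesis
    using True by (simp add: connected_safe_set_def connected_iff_strongly_connected[OF gS])
qed

section \<open>Arithmetic of the expression minimised in \<open>alpha\<close>\<close>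

definition alpha_term :: "nat \<Rightarrow> nat \<Rightarrow> nat \<Rightarrow> nat \<Rightarrow> int" where
  "alpha_term m1 m2 n1 n2 = int ((m1 + m2) * (n1 + n2)) - int (m1 * n1 + m2 * n2) +
     max \<lceil>(real (max (m1 * n1) (m2 * n2)) - real ((m1 + m2) * (n1 + n2)) +
             real (m1 * n1 + m2 * n2)) / 2\<rceil> 1"

text \<open>Removes the ceiling and the subtractions. With \<open>c\<close> off-diagonal cells and
  \<open>a\<close> cells in the larger diagonal block, the conditions say that \<open>s\<close>
  exceeds \<open>c\<close> and that the \<open>a - (s - c)\<close> cells left over after filling up
  number at most \<open>s\<close>.\<close>

lemma alpha_term_le_iff:
  "alpha_term m1 m2 n1 n2 \<le> int s \<longleftrightarrow>
     m1 * n2 + m2 * n1 + 1 \<le> s \<and> max (m1 * n1) (m2 * n2) + (m1 * n2 + m2 * n1) \<le> 2 * s"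
proof -
  define a where "a = max (m1 * n1) (m2 * n2)"
  define c where "c = m1 * n2 + m2 * n1"
  have 1: "int ((m1 + m2) * (n1 + n2)) - int (m1 * n1 + m2 * n2) = int c"
    by (simp add: c_def algebra_simps)
  have 2: "real a - real ((m1 + m2) * (n1 + n2)) + real (m1 * n1 + m2 * n2) = real a - real c"
    by (simp add: c_def algebra_simps)
  have 3: "\<lceil>(real a - real c) / 2\<rceil> \<le> int s - int c \<longleftrightarrow> a + c \<le> 2 * s"
    by (simp add: ceiling_le_iff) linarith
  have "alpha_term m1 m2 n1 n2 \<le> int s \<longleftrightarrow>
      max \<lceil>(real a - real c) / 2\<rceil> 1 \<le> int s - int c"
    unfolding alpha_term_def a_def[symmetric] 1 2 by linarith
  also have "\<dots> \<longleftrightarrow> c + 1 \<le> s \<and> a + c \<le> 2 * s"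
    using 3 by auto
  finally show ?thesis by (simp add: a_def c_def)
qed

lemma alpha_term_pos: "alpha_term m1 m2 n1 n2 > 0"
proof -
  have "int ((m1 + m2) * (n1 + n2)) - int (m1 * n1 + m2 * n2) \<ge> 0"
    by (simp add: algebra_simps)
  then show ?thesis unfolding alpha_term_def by linarith
qed

lemma alpha_term_swap: "alpha_term m1 m2 n1 n2 = alpha_term m2 m1 n2 n1"
  unfolding alpha_term_def by (simp add: ac_simps)

lemma alpha_eq_Min:
  "alpha m n = Min {alpha_term m1 m2 n1 n2 | m1 m2 n1 n2.
     m1 > 0 \<and> m2 > 0 \<and> n1 > 0 \<and> n2 > 0 \<and> m1 + m2 = m \<and> n1 + n2 = n}"
  unfolding alpha_def alpha_term_def
  by (intro arg_cong[where f = Min] Collect_cong iff_exI) auto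


section \<open>Connected safe sets from partitions\<close>

text \<open>When the first diagonal block is the larger one, the first two conditions on
  \<open>s\<close> are those of \<open>alpha_term_le_iff\<close>. The third ensures that this block
  has the \<open>s - c\<close> cells to be added to the off-diagonal ones.\<close>

lemma exists_connected_safe_set:
  fixes m1 m2 n1 n2 s :: nat
  defines "a \<equiv> m1 * n1" and "c \<equiv> m1 * n2 + m2 * n1"
  assumes pos: "m1 > 0" "m2 > 0" "n1 > 0" "n2 > 0"
    and le: "m2 * n2 \<le> a"
    and s: "c + 1 \<le> s" "a + c \<le> 2 * s" "s \<le> a + c"
  shows "\<exists>S. connected_safe_set (K_box_K (m1 + m2) (n1 + n2)) S \<and> card S = s"
proof -
  define G where "G = K_box_K (m1 + m2) (n1 + n2)"
  define V where "V = {1..m1 + m2} \<times> {1..n1 + n2}"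
  define A where "A = {1..m1} \<times> {1..n1}"
  define B where "B = {m1 + 1..m1 + m2} \<times> {n1 + 1..n1 + n2}"
  define C where "C = {1..m1} \<times> {n1 + 1..n1 + n2} \<union> {m1 + 1..m1 + m2} \<times> {1..n1}"
  have fin: "finite A" "finite B" "finite C" by (auto simp: A_def B_def C_def)
  have cards: "card A = a" "card B = m2 * n2" "card C = c"
    unfolding A_def B_def C_def a_def c_def
    by (auto simp: card_cartesian_product intro!: trans[OF card_Un_disjoint])
  have V: "V = A \<union> B \<union> C" by (auto simp: V_def A_def B_def C_def)
  have disj: "A \<inter> C = {}" "B \<inter> C = {}" "A \<inter> B = {}" by (auto simp: A_def B_def C_def)
  have "s - c \<le> card A" using s cards by simp
  then obtain X where X: "X \<subseteq> A" "card X = s - c" by (meson obtain_subset_with_card_n)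
  define S where "S = C \<union> X"
  have SV: "S \<subseteq> V" using X V by (auto simp: S_def)
  have cS: "card S = s"
    using X disj fin s cards unfolding S_def
    by (subst card_Un_disjoint) (auto intro: finite_subset)
  have "X \<noteq> {}" using X s by auto
  then obtain i j where ij: "(i, j) \<in> X" by auto
  have gS: "graph (G \<restriction> S)"
    unfolding G_def using SV by (intro graph_induce_subgraph[OF graph_K_box_K]) (simp add: V_def)
  have gT: "graph (G \<restriction> (V - S))"
    unfolding G_def by (intro graph_induce_subgraph[OF graph_K_box_K]) (auto simp: V_def)
  interpret S: graph "G \<restriction> S" by (fact gS)
  have adj: "p \<rightarrow>\<^sup>*\<^bsub>G \<restriction> S\<^esub> q" if "p \<in> S" "q \<in> S" "fst p = fst q \<or> snd p = snd q" for p q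
  proof (cases "p = q")
    case False
    then have "p \<rightarrow>\<^bsub>G \<restriction> S\<^esub> q"
      unfolding dominates_induce_subgraph G_def dominates_K_box_K
      using that SV by (auto simp: V_def)
    then show ?thesis by blast
  qed (use that in simp)
  \<comment> \<open>Every cell is linked to one fixed added cell \<open>(i, j)\<close>. Off-diagonal
    cells need one corner; another cell of \<open>X\<close> first leaves its row through column
    \<open>n1 + 1\<close>, which exists because \<open>n2 > 0\<close>.\<close>
  have hub: "p \<rightarrow>\<^sup>*\<^bsub>G \<restriction> S\<^esub> (i, j)" if p: "p \<in> S" for p
  proof -
    have ijA: "i \<in> {1..m1}" "j \<in> {1..n1}" using ij X by (auto simp: A_def)
    obtain k l where kl: "p = (k, l)" by force
    have ijS: "(i, j) \<in> S" using ij by (simp add: S_def)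
    consider "k \<in> {1..m1}" "l \<in> {1..n1}" | "k \<in> {1..m1}" "l \<in> {n1 + 1..n1 + n2}"
      | "k \<in> {m1 + 1..m1 + m2}" "l \<in> {1..n1}"
      using p X by (auto simp: kl S_def A_def C_def)
    then show ?thesis
    proof cases
      case 1
      have in_C: "(k, n1 + 1) \<in> S" "(i, n1 + 1) \<in> S"
        using 1 ijA pos by (auto simp: S_def C_def)
      have "p \<rightarrow>\<^sup>*\<^bsub>G \<restriction> S\<^esub> (k, n1 + 1)" by (rule adj) (use p in_C in \<open>auto simp: kl\<close>)
      also have "\<dots> \<rightarrow>\<^sup>*\<^bsub>G \<restriction> S\<^esub> (i, n1 + 1)" by (rule adj) (use in_C in auto)
      also have "\<dots> \<rightarrow>\<^sup>*\<^bsub>G \<restriction> S\<^esub> (i, j)" by (rule adj) (use in_C ijS in auto)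
      finally show ?thesis .
    next
      case 2
      then have in_C: "(i, l) \<in> S" using ijA by (auto simp: S_def C_def)
      have "p \<rightarrow>\<^sup>*\<^bsub>G \<restriction> S\<^esub> (i, l)" by (rule adj) (use p in_C in \<open>auto simp: kl\<close>)
      also have "\<dots> \<rightarrow>\<^sup>*\<^bsub>G \<restriction> S\<^esub> (i, j)" by (rule adj) (use in_C ijS in auto)
      finally show ?thesis .
    next
      case 3
      then have in_C: "(k, j) \<in> S" using ijA by (auto simp: S_def C_def)
      have "p \<rightarrow>\<^sup>*\<^bsub>G \<restriction> S\<^esub> (k, j)" by (rule adj) (use p in_C in \<open>auto simp: kl\<close>)
      also have "\<dots> \<rightarrow>\<^sup>*\<^bsub>G \<restriction> S\<^esub> (i, j)" by (rule adj) (use in_C ijS in auto)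
      finally show ?thesis .
    qed
  qed
  have sc: "strongly_connected (G \<restriction> S)"
    unfolding strongly_connected_def
  proof (intro conjI ballI)
    show "verts (G \<restriction> S) \<noteq> {}" using ij by (auto simp: S_def)
    fix p q assume "p \<in> verts (G \<restriction> S)" "q \<in> verts (G \<restriction> S)"
    then have "p \<rightarrow>\<^sup>*\<^bsub>G \<restriction> S\<^esub> (i, j)" "(i, j) \<rightarrow>\<^sup>*\<^bsub>G \<restriction> S\<^esub> q"
      using hub S.symmetric_reachable' by auto
    then show "p \<rightarrow>\<^sup>*\<^bsub>G \<restriction> S\<^esub> q" by (rule S.reachable_trans)
  qed
  have T: "V - S = (A - X) \<union> B" using V disj X by (auto simp: S_def)
  have small: "card D \<le> card S" if D: "D \<in> pre_digraph.sccs_verts (G \<restriction> (V - S))" for D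
  proof -
    have DT: "D \<subseteq> V - S" using Union_sccs_verts[OF gT] D by auto
    obtain u where u: "u \<in> D" using D unfolding pre_digraph.sccs_verts_def by auto
    consider "u \<in> A - X" | "u \<in> B" using u DT T by auto
    then show ?thesis
    proof cases
      case 1
      \<comment> \<open>No line meets both \<open>A\<close> and \<open>B\<close>, so
        \<open>A - X\<close> is closed under adjacency in the complement. Its size is at most
        \<open>s\<close> because \<open>a + c \<le> 2 * s\<close>.\<close>
      have "D \<subseteq> A - X"
        by (rule sccs_verts_subset_closed[OF gT D u 1])
          (use T in \<open>auto simp: dominates_induce_subgraph G_def dominates_K_box_K A_def B_def\<close>)
      then have "card D \<le> card (A - X)" using fin by (intro card_mono) auto
      also have "\<dots> = a - (s - c)"
        using X fin cards by (simp add: card_Diff_subset finite_subset)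
      finally show ?thesis using cS s by simp
    next
      case 2
      have "D \<subseteq> B"
        by (rule sccs_verts_subset_closed[OF gT D u 2])
          (use T in \<open>auto simp: dominates_induce_subgraph G_def dominates_K_box_K A_def B_def\<close>)
      then have "card D \<le> m2 * n2" using fin cards by (metis card_mono)
      \<comment> \<open>As \<open>B\<close> is not larger than \<open>A\<close>, one of
        \<open>m2 \<le> m1\<close> and \<open>n2 \<le> n1\<close> holds. Hence
        \<open>m2 * n2\<close> is at most one of the two summands of \<open>c\<close>.\<close>
      also have "\<dots> \<le> c"
      proof (cases "m2 \<le> m1")
        case False
        then have "n2 \<le> n1" using le mult_le_mono[of m1 m2 n1 n2] pos
          by (metis a_def less_imp_le mult_less_le_imp_less not_le)
        then show ?thesis by (simp add: c_def trans_le_add2)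
      qed (simp add: c_def trans_le_add1)
      finally show ?thesis using cS s by simp
    qed
  qed
  have "connected_safe_set G S"
    unfolding G_def connected_safe_set_K_box_K_iff
    using SV sc small by (simp add: V_def G_def)
  with cS show ?thesis unfolding G_def by blast
qed

text \<open>Swapping both index pairs at once exchanges the diagonal blocks and keeps the term, so
  the first block may be taken to be the larger one.\<close>

lemma connected_safe_set_of_alpha_term:
  assumes pos: "m1 > 0" "m2 > 0" "n1 > 0" "n2 > 0"
  shows "\<exists>S. connected_safe_set (K_box_K (m1 + m2) (n1 + n2)) S \<and>
    int (card S) = alpha_term m1 m2 n1 n2"
proof -
  have *: "\<exists>S. connected_safe_set (K_box_K (m1 + m2) (n1 + n2)) S \<and>
      int (card S) = alpha_term m1 m2 n1 n2"
    if pos: "m1 > 0" "m2 > 0" "n1 > 0" "n2 > 0" and le: "m2 * n2 \<le> m1 * n1"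
    for m1 m2 n1 n2 :: nat
  proof -
    define s where "s = nat (alpha_term m1 m2 n1 n2)"
    have s: "int s = alpha_term m1 m2 n1 n2"
      using alpha_term_pos[of m1 m2 n1 n2] by (simp add: s_def)
    have "m1 * n1 > 0" using pos by simp
    \<comment> \<open>This is the criterion at \<open>s = a + c\<close>, for \<open>a\<close> the
      size of the first block and \<open>c\<close> that of the off-diagonal part; it needs only
      \<open>a > 0\<close>.\<close>
    then have "alpha_term m1 m2 n1 n2 \<le> int (m1 * n1 + (m1 * n2 + m2 * n1))"
      unfolding alpha_term_le_iff using le by (simp add: max_absorb1)
    then have "s \<le> m1 * n1 + (m1 * n2 + m2 * n1)"
      unfolding s[symmetric] by (simp only: of_nat_le_iff)
    moreover have "m1 * n2 + m2 * n1 + 1 \<le> s \<and> m1 * n1 + (m1 * n2 + m2 * n1) \<le> 2 * s"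
      using alpha_term_le_iff[of m1 m2 n1 n2 s] s le by (simp add: max_absorb1)
    ultimately show ?thesis
      using exists_connected_safe_set[OF pos le] s by metis
  qed
  have swapped: "\<exists>S. connected_safe_set (K_box_K (m2 + m1) (n2 + n1)) S \<and>
      int (card S) = alpha_term m2 m1 n2 n1" if "m1 * n1 \<le> m2 * n2"
    using *[OF pos(2,1,4,3) that] .
  show ?thesis
  proof (cases "m2 * n2 \<le> m1 * n1")
    case True
    then show ?thesis by (rule *[OF pos])
  next
    case False
    then show ?thesis
      using swapped by (simp add: add.commute alpha_term_swap[of m1 m2 n1 n2])
  qed
qed


section \<open>Partitions from connected safe sets\<close>

text \<open>
  Every class \<open>X\<close> is charged to the cells in the rows of \<open>D\<close> and the columns of \<open>X\<close>, or vice versa.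
  These cells avoid \<open>T\<close>, are disjoint for different \<open>X\<close>, and number at least \<open>card X\<close> because \<open>D\<close>
  is largest.
\<close>

lemma card_le_of_disjoint_lines:
  fixes T :: "(nat \<times> nat) set"
  assumes V: "V = I \<times> J" "T \<subseteq> V" "finite V"
    and P: "\<Union> P = T"
    and lines: "\<And>X Y p q. \<lbrakk>X \<in> P; Y \<in> P; p \<in> X; q \<in> Y; fst p = fst q \<or> snd p = snd q\<rbrakk> \<Longrightarrow> X = Y"
    and D: "D \<in> P" "\<And>X. X \<in> P \<Longrightarrow> card X \<le> card D"
  shows "card (T - D) \<le> card (V - T)"
proof -
  define F where "F X = fst ` D \<times> snd ` X \<union> fst ` X \<times> snd ` D" for X
  define Q where "Q = P - {D}"
  have "finite T" using V finite_subset by blast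
  then have fin: "finite X" "X \<subseteq> T" if "X \<in> P" for X
    using that P finite_subset[of X T] by blast+
  from \<open>finite T\<close> have finQ: "finite Q" using P unfolding Q_def by (auto intro: finite_UnionD)
  have disjQ: "X \<inter> Y = {}" if "X \<in> Q" "Y \<in> Q" "X \<noteq> Y" for X Y
    using that lines[of X Y] unfolding Q_def by blast
  have TD: "T - D = \<Union> Q"
    using P D(1) lines[of _ D] unfolding Q_def by blast
  have prod: "card X \<le> card (fst ` X) * card (snd ` X)" if "X \<in> P" for X
  proof -
    have "X \<subseteq> fst ` X \<times> snd ` X" by force
    then have "card X \<le> card (fst ` X \<times> snd ` X)" using fin(1)[OF that] by (intro card_mono) auto
    then show ?thesis by (simp add: card_cartesian_product)
  qed
  have F: "card X \<le> card (F X)" if X: "X \<in> P" for X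
  proof -
    let ?r = "card (fst ` X)" and ?c = "card (snd ` X)"
    let ?R = "card (fst ` D)" and ?C = "card (snd ` D)"
    have finF: "finite (F X)" using fin(1)[OF X] fin(1)[OF D(1)] by (simp add: F_def)
    have "?R * ?c \<le> card (F X)"
      using card_mono[OF finF, of "fst ` D \<times> snd ` X"] by (simp add: F_def card_cartesian_product)
    moreover have "?r * ?C \<le> card (F X)"
      using card_mono[OF finF, of "fst ` X \<times> snd ` D"] by (simp add: F_def card_cartesian_product)
    moreover have "card X \<le> ?r * ?c" "card X \<le> ?R * ?C"
      using prod[OF X] prod[OF D(1)] D(2)[OF X] by auto
    \<comment> \<open>If \<open>X\<close> meets no more rows than \<open>D\<close>, the block of
      \<open>D\<close>-rows and \<open>X\<close>-columns has at least \<open>card X\<close> cells.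
      Otherwise the block of \<open>X\<close>-rows and \<open>D\<close>-columns has at least
      \<open>card D\<close> cells, and \<open>D\<close> is largest.\<close>
    moreover have "?r * ?c \<le> ?R * ?c \<or> ?R * ?C \<le> ?r * ?C"
      by (cases "?r \<le> ?R") auto
    ultimately show ?thesis by linarith
  qed
  have F_sub: "F X \<subseteq> V - T" if X: "X \<in> Q" for X
  proof
    fix p assume p: "p \<in> F X"
    have "X \<subseteq> V" "D \<subseteq> V" using X D(1) fin(2) V(2) unfolding Q_def by blast+
    with p V(1) have "p \<in> V" by (fastforce simp: F_def)
    moreover have "p \<notin> T"
    proof
      assume "p \<in> T"
      then obtain Y where Y: "Y \<in> P" "p \<in> Y" using P by blast
      obtain x d where "x \<in> X" "d \<in> D" "fst p = fst d \<and> snd p = snd x \<or> fst p = fst x \<and> snd p = snd d"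
        using p unfolding F_def by auto
      \<comment> \<open>The cell \<open>p\<close> has one coordinate in common with \<open>X\<close>
        and the other with \<open>D\<close>, so its class would equal both.\<close>
      then have "Y = X" "Y = D"
        using X Y D(1) lines[of Y X p x] lines[of Y D p d] unfolding Q_def by auto
      then show False using X by (simp add: Q_def)
    qed
    ultimately show "p \<in> V - T" by blast
  qed
  have F_disj: "F X \<inter> F Y = {}" if XY: "X \<in> Q" "Y \<in> Q" "X \<noteq> Y" for X Y
  proof (rule ccontr)
    assume "F X \<inter> F Y \<noteq> {}"
    then obtain p where p: "p \<in> F X" "p \<in> F Y" by blast
    have PP: "X \<in> P" "Y \<in> P" "X \<noteq> D" "Y \<noteq> D" using XY by (auto simp: Q_def)
    obtain x d where x: "x \<in> X" "d \<in> D"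
      "fst p = fst d \<and> snd p = snd x \<or> fst p = fst x \<and> snd p = snd d"
      using p(1) unfolding F_def by auto
    obtain y e where y: "y \<in> Y" "e \<in> D"
      "fst p = fst e \<and> snd p = snd y \<or> fst p = fst y \<and> snd p = snd e"
      using p(2) unfolding F_def by auto
    \<comment> \<open>The coordinate that \<open>p\<close> takes from \<open>x\<close> comes also
      from \<open>y\<close> or from \<open>e\<close>, which puts \<open>x\<close> on a line with
      \<open>Y\<close> or with \<open>D\<close>.\<close>
    have "fst x = fst y \<or> snd x = snd y \<or> fst x = fst e \<or> snd x = snd e"
      using x(3) y(3) by metis
    then show False
      using lines[OF PP(1,2) x(1) y(1)] lines[OF PP(1) D(1) x(1) y(2)] XY(3) PP(3) by blast
  qed
  have "card (T - D) = (\<Sum>X\<in>Q. card X)"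
    unfolding TD using disjQ fin(1)
    by (intro card_Union_disjoint) (auto simp: Q_def pairwise_def disjnt_def)
  also have "\<dots> \<le> (\<Sum>X\<in>Q. card (F X))"
    by (intro sum_mono F) (simp add: Q_def)
  also have "\<dots> = card (\<Union>X\<in>Q. F X)"
    using finQ fin(1) D(1) F_disj
    by (intro card_UN_disjoint[symmetric]) (auto simp: F_def Q_def)
  also have "\<dots> \<le> card (V - T)"
    using F_sub V(3) by (intro card_mono) auto
  finally show ?thesis .
qed

lemma alpha_term_le_of_connected_safe_set:
  assumes mn: "m \<ge> 3" "n \<ge> 3"
    and S: "connected_safe_set (K_box_K m n) S"
  shows "\<exists>m1 m2 n1 n2. m1 > 0 \<and> m2 > 0 \<and> n1 > 0 \<and> n2 > 0 \<and> m1 + m2 = m \<and> n1 + n2 = n \<and>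
    alpha_term m1 m2 n1 n2 \<le> int (card S)"
proof -
  define G where "G = K_box_K m n"
  define V where "V = {1..m} \<times> {1..n}"
  define T where "T = V - S"
  define P where "P = pre_digraph.sccs_verts (G \<restriction> T)"
  have "S \<subseteq> V \<and> strongly_connected (G \<restriction> S) \<and> (\<forall>D \<in> P. card D \<le> card S)"
    using S unfolding connected_safe_set_K_box_K_iff G_def V_def T_def P_def .
  then have SV: "S \<subseteq> V" and sc: "strongly_connected (G \<restriction> S)"
    and small: "\<And>D. D \<in> P \<Longrightarrow> card D \<le> card S" by auto
  have finV: "finite V" and cV: "card V = m * n" by (auto simp: V_def card_cartesian_product)
  have TV: "T \<subseteq> V" and ST: "S = V - T" using SV by (auto simp: T_def)
  have finT: "finite T" and finS: "finite S" using finV TV SV finite_subset by auto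
  have cST: "card S + card T = m * n"
    using cV finV TV ST by (metis card_Diff_subset card_mono finT le_add_diff_inverse2)
  have gT: "graph (G \<restriction> T)"
    unfolding G_def using TV by (intro graph_induce_subgraph[OF graph_K_box_K]) (simp add: V_def)
  have gS: "graph (G \<restriction> S)"
    unfolding G_def using SV by (intro graph_induce_subgraph[OF graph_K_box_K]) (simp add: V_def)
  have UP: "\<Union> P = T" using Union_sccs_verts[OF gT] by (simp add: P_def)
  have nonempty: "X \<noteq> {}" if "X \<in> P" for X
    using that unfolding P_def pre_digraph.sccs_verts_def by blast
  interpret T: graph "G \<restriction> T" by (fact gT)
  have lines: "X = Y"
    if "X \<in> P" "Y \<in> P" "p \<in> X" "q \<in> Y" "fst p = fst q \<or> snd p = snd q" for X Y p q
  proof -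
    have "q \<in> X"
    proof (cases "p = q")
      case False
      have "p \<in> T" "q \<in> T" using that UP by auto
      then have "p \<rightarrow>\<^bsub>G \<restriction> T\<^esub> q"
        unfolding dominates_induce_subgraph G_def dominates_K_box_K
        using that(5) False TV unfolding V_def by blast
      then show ?thesis
        using sccs_verts_closed[OF gT _ that(3)] that(1) unfolding P_def by blast
    qed (use that in simp)
    then show ?thesis using that T.sccs_verts_disjoint[of X Y] unfolding P_def by blast
  qed
  show ?thesis
  proof (cases "card T \<le> card S")
    case True
    obtain k l where kl: "m = k + 3" "n = l + 3"
      using mn by (metis add.commute le_Suc_ex)
    \<comment> \<open>The off-diagonal part has \<open>m + n - 2\<close> cells, so
      \<open>m + n - 1 \<le> card S\<close> is required. Since
      \<open>(m - 2) * (n - 2) \<ge> 1\<close>, twice \<open>card S\<close> is at least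
      \<open>m * n \<ge> 2 * (m + n - 1) - 1\<close>, and integrality gives the bound. It is needed
      at \<open>m = n = 3\<close>.\<close>
    have "alpha_term (m - 1) 1 (n - 1) 1 \<le> int (card S)"
      unfolding alpha_term_le_iff using True cST by (auto simp: kl algebra_simps)
    then show ?thesis
      using mn by (intro exI[of _ "m - 1"] exI[of _ 1] exI[of _ "n - 1"]) auto
  next
    case False
    have "finite P" using T.finite_sccs_verts by (simp add: P_def)
    moreover have "P \<noteq> {}" using False UP by auto
    ultimately have Max: "Max (card ` P) \<in> card ` P" "\<And>X. X \<in> P \<Longrightarrow> card X \<le> Max (card ` P)"
      by simp_all
    then obtain D where D: "D \<in> P" "\<And>X. X \<in> P \<Longrightarrow> card X \<le> card D"
      by (metis imageE)
    have DT: "D \<subseteq> T" using D(1) UP by blast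
    have cT: "card T = card D + card (T - D)"
      using DT finT by (metis card_Diff_subset card_mono finite_subset le_add_diff_inverse)
    \<comment> \<open>Safety bounds each component separately; bounding the union of all components
      other than \<open>D\<close> takes the charging argument.\<close>
    have rest: "card (T - D) \<le> card S"
      unfolding ST by (rule card_le_of_disjoint_lines[OF V_def TV finV UP]) (fact lines D)+
    \<comment> \<open>Only the lines met by \<open>T - D\<close> go to the second part. Lines that
      miss \<open>T\<close> altogether join those of \<open>D\<close>.\<close>
    define A2 where "A2 = fst ` (T - D)"
    define B2 where "B2 = snd ` (T - D)"
    define A1 where "A1 = {1..m} - A2"
    define B1 where "B1 = {1..n} - B2"
    \<comment> \<open>Safety gives \<open>card D \<le> card S < card T\<close>, so \<open>D\<close>
      is not the whole complement.\<close>
    have "T - D \<noteq> {}" using False small[OF D(1)] cT by (metis add_0_right card.empty)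
    then have ne2: "A2 \<noteq> {}" "B2 \<noteq> {}" by (auto simp: A2_def B2_def)
    have sub2: "A2 \<subseteq> {1..m}" "B2 \<subseteq> {1..n}" using TV by (auto simp: A2_def B2_def V_def)
    then have fin: "finite A1" "finite B1" "finite A2" "finite B2"
      by (auto simp: A1_def B1_def intro: finite_subset)
    have sep: "fst p \<noteq> fst q" "snd p \<noteq> snd q" if pq: "p \<in> D" "q \<in> T - D" for p q
    proof -
      obtain Y where "Y \<in> P" "q \<in> Y" using pq(2) UP by blast
      then show "fst p \<noteq> fst q" "snd p \<noteq> snd q"
        using lines[OF D(1) _ pq(1)] pq(2) by blast+
    qed
    have D1: "D \<subseteq> A1 \<times> B1"
    proof
      fix p assume p: "p \<in> D"
      then have "p \<in> V" using DT TV by blast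
      moreover have "fst p \<notin> A2" "snd p \<notin> B2"
        using sep[OF p] unfolding A2_def B2_def by auto
      ultimately show "p \<in> A1 \<times> B1" by (auto simp: A1_def B1_def V_def mem_Times_iff)
    qed
    have D2: "T - D \<subseteq> A2 \<times> B2" by (force simp: A2_def B2_def)
    have ne1: "A1 \<noteq> {}" "B1 \<noteq> {}" using D1 nonempty[OF D(1)] by auto
    define m1 where "m1 = card A1"
    define m2 where "m2 = card A2"
    define n1 where "n1 = card B1"
    define n2 where "n2 = card B2"
    note defs = m1_def m2_def n1_def n2_def
    have pos: "m1 > 0" "m2 > 0" "n1 > 0" "n2 > 0"
      using fin ne1 ne2 by (auto simp: defs card_gt_0_iff)
    have m: "m1 + m2 = m"
      using card_Diff_subset[OF fin(3) sub2(1)] card_mono[OF _ sub2(1)] by (simp add: defs A1_def)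
    have n: "n1 + n2 = n"
      using card_Diff_subset[OF fin(4) sub2(2)] card_mono[OF _ sub2(2)] by (simp add: defs B1_def)
    have le1: "card D \<le> m1 * n1"
      using card_mono[OF _ D1] fin by (simp add: defs card_cartesian_product)
    have le2: "card (T - D) \<le> m2 * n2"
      using card_mono[OF _ D2] fin by (simp add: defs card_cartesian_product)
    define C where "C = A1 \<times> B2 \<union> A2 \<times> B1"
    have disj: "A1 \<inter> A2 = {}" "B1 \<inter> B2 = {}" by (auto simp: A1_def B1_def)
    have CS: "C \<subseteq> S"
      using D1 D2 sub2 disj unfolding C_def ST V_def by (auto simp: A1_def B1_def)
    have cC: "card C = m1 * n2 + m2 * n1"
      unfolding C_def using fin disj
      by (subst card_Un_disjoint) (auto simp: defs card_cartesian_product)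
    \<comment> \<open>The blocks \<open>A1 \<times> B2\<close> and \<open>A2 \<times> B1\<close> are
      nonempty and no line meets both, so their union is disconnected.\<close>
    have "C \<noteq> S"
    proof
      assume CS: "C = S"
      obtain i j k l where ij: "i \<in> A1" "j \<in> B2" and kl: "k \<in> A2" "l \<in> B1"
        using ne1 ne2 by blast
      have "verts (G \<restriction> S) \<subseteq> A1 \<times> B2"
      proof (rule strongly_connected_closed[OF gS sc])
        show "(i, j) \<in> verts (G \<restriction> S)" using ij by (simp add: CS[symmetric] C_def)
        show "(i, j) \<in> A1 \<times> B2" using ij by simp
        fix p q assume "p \<in> A1 \<times> B2" "p \<rightarrow>\<^bsub>G \<restriction> S\<^esub> q"
        then show "q \<in> A1 \<times> B2"
          unfolding dominates_induce_subgraph G_def dominates_K_box_K CS[symmetric] C_def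
          using disj by auto
      qed
      moreover have "(k, l) \<in> S" using kl by (simp add: CS[symmetric] C_def)
      ultimately show False using kl disj by auto
    qed
    with CS have "card C < card S" using finS by (intro psubset_card_mono) auto
    moreover have "max (m1 * n1) (m2 * n2) + card C \<le> 2 * card S"
    proof -
      \<comment> \<open>Both sides count all cells of the grid. Cancelling
        \<open>card (T - D) \<le> m2 * n2\<close> leaves
        \<open>m1 * n1 + card C \<le> card S + card D\<close>; cancelling
        \<open>card D \<le> m1 * n1\<close> bounds \<open>m2 * n2 + card C\<close> in the same way.
        Both right-hand sides are at most \<open>2 * card S\<close>.\<close>
      have "card S + card D + card (T - D) = m1 * n1 + m2 * n2 + card C"
        using cST cT unfolding cC m[symmetric] n[symmetric] by (simp add: algebra_simps)
      then show ?thesis using le1 le2 rest small[OF D(1)] by linarith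
    qed
    ultimately have "alpha_term m1 m2 n1 n2 \<le> int (card S)"
      unfolding alpha_term_le_iff cC by simp
    then show ?thesis using pos m n by blast
  qed
qed

theorem theorem2p9:
  fixes m n :: nat
  assumes "m \<ge> 3" and "n \<ge> 3"
  shows "int (cs (K_box_K m n)) = alpha m n"
proof -
  define F where "F = {alpha_term m1 m2 n1 n2 | m1 m2 n1 n2.
     m1 > 0 \<and> m2 > 0 \<and> n1 > 0 \<and> n2 > 0 \<and> m1 + m2 = m \<and> n1 + n2 = n}"
  have "F \<subseteq> (\<lambda>(m1, m2, n1, n2). alpha_term m1 m2 n1 n2) ` ({..m} \<times> {..m} \<times> {..n} \<times> {..n})"
  proof
    fix x assume "x \<in> F"
    then obtain m1 m2 n1 n2 where "x = alpha_term m1 m2 n1 n2" "m1 + m2 = m" "n1 + n2 = n"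
      unfolding F_def by blast
    then show "x \<in> (\<lambda>(m1, m2, n1, n2). alpha_term m1 m2 n1 n2) ` ({..m} \<times> {..m} \<times> {..n} \<times> {..n})"
      by (intro image_eqI[where x = "(m1, m2, n1, n2)"]) auto
  qed
  then have finF: "finite F" by (rule finite_subset) simp
  have attained: "\<exists>S. connected_safe_set (K_box_K m n) S \<and> int (card S) = x" if "x \<in> F" for x
    using that connected_safe_set_of_alpha_term unfolding F_def by blast
  \<comment> \<open>Some term must exist, so that there is a connected safe set at all and the
    \<open>LEAST\<close> in \<open>cs\<close> is attained.\<close>
  have "alpha_term 1 (m - 1) 1 (n - 1) \<in> F"
    unfolding F_def using assms
    by (intro CollectI exI[of _ "1::nat"] exI[of _ "m - 1"] exI[of _ "n - 1"]) auto
  then have neF: "F \<noteq> {}" by blast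
  then obtain S0 where "connected_safe_set (K_box_K m n) S0" using attained by blast
  then have "\<exists>k S. connected_safe_set (K_box_K m n) S \<and> card S = k" by blast
  then have "\<exists>S. connected_safe_set (K_box_K m n) S \<and> card S = cs (K_box_K m n)"
    unfolding cs_def by (rule LeastI_ex)
  then obtain S where S: "connected_safe_set (K_box_K m n) S" "card S = cs (K_box_K m n)" by blast
  obtain m1 m2 n1 n2 where mn: "m1 > 0" "m2 > 0" "n1 > 0" "n2 > 0" "m1 + m2 = m" "n1 + n2 = n"
    and x_le: "alpha_term m1 m2 n1 n2 \<le> int (cs (K_box_K m n))"
    using alpha_term_le_of_connected_safe_set[OF assms S(1)] unfolding S(2) by blast
  define x where "x = alpha_term m1 m2 n1 n2"
  have x: "x \<in> F" "x \<le> int (cs (K_box_K m n))"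
    using mn x_le unfolding F_def x_def by blast+
  have le: "int (cs (K_box_K m n)) \<le> y" if y: "y \<in> F" for y
  proof -
    obtain S' where "connected_safe_set (K_box_K m n) S'" "int (card S') = y"
      using attained[OF y] by blast
    moreover from this have "cs (K_box_K m n) \<le> card S'"
      unfolding cs_def by (intro Least_le exI[of _ S']) simp
    ultimately show ?thesis by simp
  qed
  have "alpha m n = Min F" unfolding alpha_eq_Min F_def ..
  also have "Min F = int (cs (K_box_K m n))"
  proof (rule Min_eqI[OF finF le])
    \<comment> \<open>The term \<open>x\<close> obtained from an optimal safe set is at most
      \<open>cs\<close>, while every term is the size of a connected safe set and hence at least
      \<open>cs\<close>.\<close>
    have "x = int (cs (K_box_K m n))" using le[OF x(1)] x(2) by simp
    with x(1) show "int (cs (K_box_K m n)) \<in> F" by simp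
  qed
  finally show ?thesis by simp
qed

end
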